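(* Let $(X,x_0)$ be a pointed operator metric space and let $n\in\mathbb{N}$. The map \[\delta_X^n:X\to \mathcal{F}^n(X),\qquad \delta_X^n(x)=\delta_x,\] is an $n$-isometric embedding, i.e. its $n$-th amplification $\mathrm{M}_n(X)\to\mathrm{M}_n(\mathcal{F}^n(X))$, $[x_{ij}]\mapsto[\delta_{x_{ij}}]$, is an isometry (distance preserving).
   Context: An operator metric space is a subset $X\subset\mathcal{B}(H)$, $H$ a (complex) Hilbert space; $\mathrm{M}_n(X)$ is the set of $n\times n$ matrices with entries in $X$, with the metric inherited from $\mathcal{B}(H^{\oplus n})$ ($H^{\oplus n}$ the $\ell_2$-sum); distances are written $\|[x_{ij}-y_{ij}]\|_{\mathrm{M}_n(X)}$. A pointed operator metric space is a pair $(X,x_0)$ with $x_0\in X$. For a map $f$, its $n$-th amplification is $f_n([x_{ij}])=[f(x_{ij})]$ and $\mathrm{Lip}_n(f)$ is the Lipschitz constant of $f_n$. $\mathrm{Lip}_0(X,\mathbb{C})$ is the vector space of Lipschitz maps $f:X\to\mathbb{C}$ with $f(x_0)=0$. $\mathrm{Lip}_0^n(X,\mathbb{C})$ denotes this space with norm $\|f\|_{\mathrm{Lip},n}=\mathrm{Lip}_n(f)$ and the operator space structure given, for $[f_{ij}]\in \mathrm{M}_k(\mathrm{Lip}_0(X,\mathbb{C}))$, by $\|[f_{ij}]\|_{\mathrm{Lip},n,k}=\mathrm{Lip}_n\big([f_{ij}]:X\to \mathrm{M}_k\big)$, where $[f_{ij}]$ is viewed as the map $x\mapsto[f_{ij}(x)]$.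 The dual $E^*$ of an operator space $E$ is an operator space via $\mathrm{M}_k(E^* )\cong\mathrm{CB}(E,\mathrm{M}_k)$. For $x\in X$, $\delta_x\in \mathrm{Lip}_0^n(X,\mathbb{C})^*$ is $\delta_x(f)=f(x)$. The $n$-Lipschitz-free operator space is $\mathcal{F}^n(X)=\overline{\mathrm{span}}\{\delta_x: x\in X\}\subset \mathrm{Lip}_0^n(X,\mathbb{C})^*$ with the inherited operator space structure. *)

theory Defs
  imports "HOL-Analysis.Analysis"
begin

section \<open>Complex Hilbert spaces\<close>

text \<open>
  The norm and the completeness come from the underlying real Hilbert space, whose inner product
  is the real part of the complex one.  The complex inner product is linear in its first argument.
\<close>

class complex_hilbert = real_inner + complete_space +
  fixes scaleC :: "complex \<Rightarrow> 'a \<Rightarrow> 'a"  (infixr \<open>*\<^sub>C\<close> 75)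
    and cinner :: "'a \<Rightarrow> 'a \<Rightarrow> complex"
  assumes scaleC_add_right: "c *\<^sub>C (x + y) = c *\<^sub>C x + c *\<^sub>C y"
    and scaleC_add_left: "(c + d) *\<^sub>C x = c *\<^sub>C x + d *\<^sub>C x"
    and scaleC_scaleC: "c *\<^sub>C (d *\<^sub>C x) = (c * d) *\<^sub>C x"
    and scaleC_of_real: "complex_of_real r *\<^sub>C x = r *\<^sub>R x"
    and cinner_add_left: "cinner (x + y) z = cinner x z + cinner y z"
    and cinner_scaleC_left: "cinner (c *\<^sub>C x) y = c * cinner x y"
    and cinner_commute: "cinner x y = cnj (cinner y x)"
    and inner_eq_Re_cinner: "inner x y = Re (cinner x y)"

instantiation complex :: complex_hilbert
begin

definition scaleC_complex :: "complex \<Rightarrow> complex \<Rightarrow> complex"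
  where "scaleC_complex c z = c * z"

definition cinner_complex :: "complex \<Rightarrow> complex \<Rightarrow> complex"
  where "cinner_complex w z = w * cnj z"

instance
  by standard
    (auto simp: scaleC_complex_def cinner_complex_def inner_complex_def scaleR_conv_of_real
      algebra_simps)

end

text \<open>
  \<open>B(H)\<close>: the bounded operators of the library are only real-linear, hence the extra condition.
\<close>

definition bounded_ops :: "('h::complex_hilbert \<Rightarrow>\<^sub>L 'h) set"
  where "bounded_ops = {T. \<forall>c x. blinfun_apply T (c *\<^sub>C x) = c *\<^sub>C blinfun_apply T x}"


section \<open>Matrices\<close>

text \<open>
  An \<open>n \<times> n\<close> matrix is a function of two indices of which only the values at indices below \<open>n\<close>
  are ever used.
\<close>

definition mats :: "nat \<Rightarrow> 'a set \<Rightarrow> (nat \<Rightarrow> nat \<Rightarrow> 'a) set"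
  where "mats n S = {A. \<forall>i<n. \<forall>j<n. A i j \<in> S}"

text \<open>
  The norm of an operator matrix, indexed by a finite set \<open>I\<close>, as an operator on the
  \<open>\<ell>\<^sub>2\<close>-sum of copies of \<open>H\<close> indexed by \<open>I\<close>.
\<close>

definition opmat_norm :: "'i set \<Rightarrow> ('i \<Rightarrow> 'i \<Rightarrow> 'h \<Rightarrow> 'h::real_normed_vector) \<Rightarrow> real"
  where "opmat_norm I T =
    (SUP v \<in> {v. L2_set (\<lambda>j. norm (v j)) I \<le> 1}. L2_set (\<lambda>i. norm (\<Sum>j\<in>I. T i j (v j))) I)"

definition blinfun_mat_norm :: "nat \<Rightarrow> (nat \<Rightarrow> nat \<Rightarrow> ('h \<Rightarrow>\<^sub>L 'h::complex_hilbert)) \<Rightarrow> real"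
  where "blinfun_mat_norm n T = opmat_norm {..<n} (\<lambda>i j. blinfun_apply (T i j))"

text \<open>
  The norm of \<open>M\<^sub>a(M\<^sub>b)\<close>: an \<open>a \<times> a\<close> matrix of scalar \<open>b \<times> b\<close> matrices acts on \<open>(\<complex>\<^sup>b)\<^sup>a\<close>.
  The first two arguments of \<open>A\<close> are the outer indices.
\<close>

definition block_norm :: "nat \<Rightarrow> nat \<Rightarrow> (nat \<Rightarrow> nat \<Rightarrow> nat \<Rightarrow> nat \<Rightarrow> complex) \<Rightarrow> real"
  where "block_norm a b A =
    opmat_norm ({..<a} \<times> {..<b}) (\<lambda>(p, i) (q, j) z. A p q i j * z)"


section \<open>Duals of operator spaces of functions\<close>

text \<open>
  An operator space is given here by a vector space \<open>E\<close> of complex-valued functions (with the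
  pointwise operations) and its matrix norms \<open>N k\<close> on \<open>M\<^sub>k(E)\<close>.  The functionals are extended
  by zero outside \<open>E\<close>, so that the dual is again a space of functions of this kind.
\<close>

type_synonym 'a mat_norms = "nat \<Rightarrow> (nat \<Rightarrow> nat \<Rightarrow> 'a \<Rightarrow> complex) \<Rightarrow> real"

definition dual_space :: "('a \<Rightarrow> complex) set \<Rightarrow> 'a mat_norms \<Rightarrow> (('a \<Rightarrow> complex) \<Rightarrow> complex) set"
  where "dual_space E N = {\<phi>.
    (\<forall>f. f \<notin> E \<longrightarrow> \<phi> f = 0) \<and>
    (\<forall>f\<in>E. \<forall>g\<in>E. \<phi> (\<lambda>x. f x + g x) = \<phi> f + \<phi> g) \<and>
    (\<forall>c. \<forall>f\<in>E. \<phi> (\<lambda>x. c * f x) = c * \<phi> f) \<and>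
    (\<exists>C. \<forall>f\<in>E. cmod (\<phi> f) \<le> C * N 1 (\<lambda>_ _. f))}"

text \<open>
  The norm of \<open>CB(E, M\<^sub>m)\<close>, \<open>\<parallel>u\<parallel>\<^sub>c\<^sub>b = sup\<^sub>k \<parallel>u\<^sub>k\<parallel>\<close> with \<open>u\<^sub>k : M\<^sub>k(E) \<rightarrow> M\<^sub>k(M\<^sub>m)\<close> the amplification.
  The supremum is taken in the reals, so this is meaningful for completely bounded \<open>u\<close> only.
\<close>

definition cb_norm ::
  "('a \<Rightarrow> complex) set \<Rightarrow> 'a mat_norms \<Rightarrow> nat \<Rightarrow> (('a \<Rightarrow> complex) \<Rightarrow> nat \<Rightarrow> nat \<Rightarrow> complex) \<Rightarrow> real"
  where "cb_norm E N m u =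
    Sup {block_norm k m (\<lambda>r s i j. u (F r s) i j) | k F. k \<ge> 1 \<and> F \<in> mats k E \<and> N k F \<le> 1}"

text \<open>
  \<open>M\<^sub>m(E\<^sup>*) = CB(E, M\<^sub>m)\<close>.  Every map \<open>f \<mapsto> [\<phi>\<^sub>i\<^sub>j(f)]\<close> with \<open>\<phi>\<^sub>i\<^sub>j \<in> E\<^sup>*\<close> is completely bounded,
  since a bounded functional on an operator space is.
\<close>

definition dual_norm :: "('a \<Rightarrow> complex) set \<Rightarrow> 'a mat_norms \<Rightarrow> ('a \<Rightarrow> complex) mat_norms"
  where "dual_norm E N m \<phi> = cb_norm E N m (\<lambda>f i j. \<phi> i j f)"


section \<open>Lipschitz spaces and Lipschitz-free operator spaces\<close>

definition pointed_op_metric_space :: "('h::complex_hilbert \<Rightarrow>\<^sub>L 'h) set \<Rightarrow> ('h \<Rightarrow>\<^sub>L 'h) \<Rightarrow> bool"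
  where "pointed_op_metric_space X x0 \<longleftrightarrow> X \<subseteq> bounded_ops \<and> x0 \<in> X"

text \<open>
  Functions on \<open>X\<close> are extended by zero to all operators, which makes the extension unique and
  compatible with the pointwise operations.
\<close>

definition Lip0 ::
  "('h::complex_hilbert \<Rightarrow>\<^sub>L 'h) set \<Rightarrow> ('h \<Rightarrow>\<^sub>L 'h) \<Rightarrow> (('h \<Rightarrow>\<^sub>L 'h) \<Rightarrow> complex) set"
  where "Lip0 X x0 = {f. (\<exists>L. L-lipschitz_on X f) \<and> f x0 = 0 \<and> (\<forall>x. x \<notin> X \<longrightarrow> f x = 0)}"

text \<open>
  \<open>Lip\<^sub>n([f\<^sub>i\<^sub>j] : X \<rightarrow> M\<^sub>k)\<close>, the least Lipschitz constant of the amplification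
  \<open>M\<^sub>n(X) \<rightarrow> M\<^sub>n(M\<^sub>k)\<close>.  It exists whenever the \<open>f\<^sub>i\<^sub>j\<close> are Lipschitz.
\<close>

definition Lip_norm :: "('h::complex_hilbert \<Rightarrow>\<^sub>L 'h) set \<Rightarrow> nat \<Rightarrow> ('h \<Rightarrow>\<^sub>L 'h) mat_norms"
  where "Lip_norm X n k F = Inf {L. 0 \<le> L \<and> (\<forall>x\<in>mats n X. \<forall>y\<in>mats n X.
    block_norm n k (\<lambda>p q i j. F i j (x p q) - F i j (y p q))
      \<le> L * blinfun_mat_norm n (\<lambda>p q. x p q - y p q))}"

definition delta ::
  "('h::complex_hilbert \<Rightarrow>\<^sub>L 'h) set \<Rightarrow> ('h \<Rightarrow>\<^sub>L 'h) \<Rightarrow> ('h \<Rightarrow>\<^sub>L 'h)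
    \<Rightarrow> (('h \<Rightarrow>\<^sub>L 'h) \<Rightarrow> complex) \<Rightarrow> complex"
  where "delta X x0 x = (\<lambda>f. if f \<in> Lip0 X x0 then f x else 0)"

definition delta_span ::
  "('h::complex_hilbert \<Rightarrow>\<^sub>L 'h) set \<Rightarrow> ('h \<Rightarrow>\<^sub>L 'h) \<Rightarrow> ((('h \<Rightarrow>\<^sub>L 'h) \<Rightarrow> complex) \<Rightarrow> complex) set"
  where "delta_span X x0 = {\<lambda>f. \<Sum>x\<in>S. c x * delta X x0 x f | S c. finite S \<and> S \<subseteq> X}"

definition free_norm ::
  "('h::complex_hilbert \<Rightarrow>\<^sub>L 'h) set \<Rightarrow> ('h \<Rightarrow>\<^sub>L 'h) \<Rightarrow> nat \<Rightarrow> (('h \<Rightarrow>\<^sub>L 'h) \<Rightarrow> complex) mat_norms"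
  where "free_norm X x0 n = dual_norm (Lip0 X x0) (Lip_norm X n)"

definition free_space ::
  "('h::complex_hilbert \<Rightarrow>\<^sub>L 'h) set \<Rightarrow> ('h \<Rightarrow>\<^sub>L 'h) \<Rightarrow> nat
    \<Rightarrow> ((('h \<Rightarrow>\<^sub>L 'h) \<Rightarrow> complex) \<Rightarrow> complex) set"
  where "free_space X x0 n = {\<phi> \<in> dual_space (Lip0 X x0) (Lip_norm X n).
    \<forall>e>0. \<exists>\<psi>\<in>delta_span X x0. free_norm X x0 n 1 (\<lambda>_ _ f. \<phi> f - \<psi> f) < e}"

end

theory Submission
  imports Defs
begin

text \<open>
  For \<open>x, y \<in> M\<^sub>n(X)\<close>, the norm of \<open>[\<delta>\<^bsub>x\<^sub>i\<^sub>j\<^esub> - \<delta>\<^bsub>y\<^sub>i\<^sub>j\<^esub>]\<close> in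
  \<open>M\<^sub>n(Lip\<^sub>0\<^sup>*) = CB(Lip\<^sub>0, M\<^sub>n)\<close> is a supremum of norms of the matrices obtained by evaluating at
  the unit-ball elements \<open>F\<close> of all the spaces \<open>M\<^sub>k(Lip\<^sub>0)\<close>.  Up to the canonical shuffle
  \<open>M\<^sub>k(M\<^sub>n) \<cong> M\<^sub>n(M\<^sub>k)\<close>, evaluation at \<open>F\<close> gives \<open>F\<^sub>n(x) - F\<^sub>n(y)\<close>, where \<open>F\<close> is regarded as a
  map \<open>X \<rightarrow> M\<^sub>k\<close>; this is \<open>free_norm_delta_diff\<close>.  Since the unit ball is described by
  \<open>Lip\<^sub>n(F) \<le> 1\<close>, each of these matrices has norm at most \<open>\<parallel>x - y\<parallel>\<close>
  (\<open>free_norm_delta_diff_le\<close>).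

  The reverse inequality (\<open>free_norm_delta_diff_ge\<close>) needs maps \<open>F\<close> that norm \<open>x - y\<close>.  Compressions
  provide them.  Given \<open>v\<close> in the unit ball of \<open>H\<^sup>n\<close>, put \<open>z = (x - y) v\<close>, and choose
  an orthonormal system \<open>e\<^sub>1, \<dots>, e\<^sub>k\<close> in \<open>H\<close> whose span contains all entries of \<open>v\<close> and \<open>z\<close>.
  The map \<open>F(a) = [\<langle>(a - x\<^sub>0) e\<^sub>j, e\<^sub>i\<rangle>]\<close> is a translate of the compression to this span, so
  all its amplifications are contractive and it vanishes at \<open>x\<^sub>0\<close>.  On the other hand
  \<open>F\<^sub>n(x) - F\<^sub>n(y)\<close> maps the coordinates of \<open>v\<close> to those of \<open>z\<close>, so its norm is at least \<open>\<parallel>z\<parallel>\<close>.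
  The supremum over \<open>v\<close> is \<open>\<parallel>x - y\<parallel>\<close>.

  The suprema and infima that define the norms are taken in the reals.  They carry their intended
  meaning only for sets that are nonempty and bounded, so the inequalities above also rest on a
  priori bounds: finite matrices of bounded operators are bounded
  (\<open>opmat_apply_le_sum_onorm\<close>), and a matrix of Lipschitz functions has a finite \<open>n\<close>-Lipschitz
  constant (\<open>Lip_norm_witness\<close>).
\<close>

section \<open>Finite orthonormal systems\<close>

lemma scaleC_zero_left [simp]: "0 *\<^sub>C (x::'a::complex_hilbert) = 0"
  using scaleC_of_real[of 0 x] by simp

lemma cinner_zero_left [simp]: "cinner 0 (x::'a::complex_hilbert) = 0"
  using cinner_add_left[of 0 0 x] by simp

lemma cinner_sum_left:
  "cinner (\<Sum>i\<in>I. f i) (y::'a::complex_hilbert) = (\<Sum>i\<in>I. cinner (f i) y)"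
  by (induction I rule: infinite_finite_induct) (auto simp: cinner_add_left)

lemma cinner_sum_right:
  "cinner (y::'a::complex_hilbert) (\<Sum>i\<in>I. f i) = (\<Sum>i\<in>I. cinner y (f i))"
  by (subst cinner_commute, simp add: cinner_sum_left) (rule sum.cong[OF refl], metis cinner_commute)

lemma cinner_scaleC_right:
  "cinner (x::'a::complex_hilbert) (c *\<^sub>C y) = cnj c * cinner x y"
  by (metis cinner_commute cinner_scaleC_left complex_cnj_mult)

lemma cinner_diff_left:
  "cinner (x - y) (z::'a::complex_hilbert) = cinner x z - cinner y z"
  using cinner_add_left[of "x - y" y z] by (simp add: algebra_simps)

lemma cinner_scaleR_left:
  "cinner (r *\<^sub>R x) (y::'a::complex_hilbert) = of_real r * cinner x y"
  by (metis cinner_scaleC_left scaleC_of_real)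

text \<open>
  The real inner product fixes only the real part; Hermitian symmetry makes the imaginary part
  vanish.
\<close>

lemma cinner_self: "cinner x x = complex_of_real ((norm (x::'a::complex_hilbert))\<^sup>2)"
proof (rule complex_eqI)
  have "Im (cinner x x) = - Im (cinner x x)"
    using arg_cong[OF cinner_commute[of x x], of Im] by simp
  then show "Im (cinner x x) = Im (complex_of_real ((norm x)\<^sup>2))" by simp
qed (simp add: power2_norm_eq_inner inner_eq_Re_cinner)

definition orthonormal :: "nat \<Rightarrow> (nat \<Rightarrow> 'a::complex_hilbert) \<Rightarrow> bool"
  where "orthonormal k e \<longleftrightarrow> (\<forall>i<k. \<forall>j<k. cinner (e i) (e j) = (if i = j then 1 else 0))"

lemma cinner_orthonormal_combination:
  assumes "orthonormal k e" and "i < k"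
  shows "cinner (\<Sum>j<k. c j *\<^sub>C e j) (e i) = c i"
proof -
  have "cinner (\<Sum>j<k. c j *\<^sub>C e j) (e i) = (\<Sum>j<k. if j = i then c j else 0)"
    using assms unfolding cinner_sum_left cinner_scaleC_left orthonormal_def
    by (intro sum.cong) auto
  then show ?thesis using assms(2) by simp
qed

text \<open>
  Parseval: the coordinate map of an orthonormal system is an isometry from \<open>\<ell>\<^sub>2\<close> onto its span.
\<close>

lemma norm_orthonormal_combination:
  assumes "orthonormal k e"
  shows "norm (\<Sum>j<k. c j *\<^sub>C e j) = L2_set (\<lambda>j. cmod (c j)) {..<k}"
proof -
  let ?w = "\<Sum>j<k. c j *\<^sub>C e j"
  have "cinner ?w ?w = (\<Sum>i<k. cnj (c i) * cinner ?w (e i))"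
    unfolding cinner_sum_right cinner_scaleC_right ..
  also have "\<dots> = (\<Sum>i<k. complex_of_real ((cmod (c i))\<^sup>2))"
    using cinner_orthonormal_combination[OF assms]
    by (intro sum.cong) (simp_all add: mult.commute flip: complex_norm_square)
  finally have "(norm ?w)\<^sup>2 = (\<Sum>i<k. (cmod (c i))\<^sup>2)"
    unfolding cinner_self of_real_sum[symmetric] of_real_eq_iff .
  then show ?thesis
    unfolding L2_set_def by (metis norm_ge_zero real_sqrt_unique)
qed

lemma Bessel_inequality:
  assumes "orthonormal k e"
  shows "L2_set (\<lambda>i. cmod (cinner z (e i))) {..<k} \<le> norm z"
proof -
  define w where "w = (\<Sum>j<k. cinner z (e j) *\<^sub>C e j)"
  have "cinner (z - w) w = (\<Sum>i<k. cnj (cinner z (e i)) * cinner (z - w) (e i))"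
    by (subst (2) w_def) (simp only: cinner_sum_right cinner_scaleC_right)
  also have "\<dots> = 0"
    using cinner_orthonormal_combination[OF assms, of _ "\<lambda>j. cinner z (e j)"]
    by (intro sum.neutral) (simp add: cinner_diff_left w_def)
  finally have "orthogonal (z - w) w"
    by (simp add: orthogonal_def inner_eq_Re_cinner)
  then have "(norm z)\<^sup>2 = (norm (z - w))\<^sup>2 + (norm w)\<^sup>2"
    using norm_add_Pythagorean[of "z - w" w] by simp
  then have "norm w \<le> norm z"
    by (intro power2_le_imp_le[of "norm w" "norm z"]) auto
  then show ?thesis
    using norm_orthonormal_combination[OF assms, of "\<lambda>j. cinner z (e j)"] by (simp add: w_def)
qed

text \<open>
  The Gram-Schmidt process, one vector at a time: the system is extended by the normalised component
  of the new vector orthogonal to it, unless that component is zero.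
\<close>

lemma finite_subset_orthonormal_span:
  assumes "finite (V :: 'a::complex_hilbert set)"
  shows "\<exists>k e. orthonormal k e \<and> (\<forall>v\<in>V. v = (\<Sum>j<k. cinner v (e j) *\<^sub>C e j))"
  using assms
proof (induction V rule: finite_induct)
  case empty
  then show ?case by (intro exI[of _ 0]) (simp add: orthonormal_def)
next
  case (insert u V)
  then obtain k e where e: "orthonormal k e"
    and V: "\<And>v. v \<in> V \<Longrightarrow> v = (\<Sum>j<k. cinner v (e j) *\<^sub>C e j)" by blast
  define w where "w = u - (\<Sum>j<k. cinner u (e j) *\<^sub>C e j)"
  have w_perp: "cinner w (e i) = 0" if "i < k" for i
    unfolding w_def cinner_diff_left using cinner_orthonormal_combination[OF e that] by simp
  show ?case
  proof (cases "w = 0")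
    case True
    then have "u = (\<Sum>j<k. cinner u (e j) *\<^sub>C e j)" by (simp add: w_def)
    with e V show ?thesis by blast
  next
    case False
    define d where "d = inverse (norm w) *\<^sub>R w"
    define e' where "e' = e(k := d)"
    have d_perp: "cinner d (e i) = 0" "cinner (e i) d = 0" if "i < k" for i
      using w_perp[OF that] cinner_commute[of "e i" d] by (simp_all add: d_def cinner_scaleR_left)
    have "norm d = 1" using False by (simp add: d_def)
    then have d_unit: "cinner d d = 1" by (simp add: cinner_self)
    have e': "orthonormal (Suc k) e'"
      using e d_perp d_unit by (auto simp: orthonormal_def e'_def less_Suc_eq)
    have split: "(\<Sum>j<Suc k. cinner v (e' j) *\<^sub>C e' j)
        = (\<Sum>j<k. cinner v (e j) *\<^sub>C e j) + cinner v d *\<^sub>C d" for v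
      by (simp add: e'_def)
    have w_d: "w = norm w *\<^sub>R d" using False by (simp add: d_def)
    have comb_d: "cinner (\<Sum>j<k. c j *\<^sub>C e j) d = 0" for c
      using d_perp by (simp add: cinner_sum_left cinner_scaleC_left)
    have "cinner u d = cinner w d"
      unfolding w_def cinner_diff_left comb_d by simp
    also have "\<dots> = norm w"
      by (subst w_d) (simp add: cinner_scaleR_left d_unit)
    finally have "cinner u d *\<^sub>C d = w" using w_d by (simp add: scaleC_of_real)
    then have "u = (\<Sum>j<Suc k. cinner u (e' j) *\<^sub>C e' j)"
      unfolding split by (simp add: w_def)
    moreover have "v = (\<Sum>j<Suc k. cinner v (e' j) *\<^sub>C e' j)" if "v \<in> V" for v
      using V[OF that] comb_d[of "\<lambda>j. cinner v (e j)"] unfolding split by simp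
    ultimately show ?thesis using e' by blast
  qed
qed

section \<open>Norms of operator matrices\<close>

lemma L2_set_Times:
  assumes "\<And>a b. f (a, b) \<ge> 0"
  shows "L2_set f (A \<times> B) = L2_set (\<lambda>a. L2_set (\<lambda>b. f (a, b)) B) A"
  unfolding L2_set_def by (simp add: sum_nonneg sum.cartesian_product case_prod_unfold)

lemma L2_set_reindex:
  assumes "inj_on h I"
  shows "L2_set f (h ` I) = L2_set (\<lambda>i. f (h i)) I"
  unfolding L2_set_def by (simp add: sum.reindex[OF assms])

text \<open>
  A crude bound, whose purpose is that the supremum defining the norm is over a bounded set.
\<close>

lemma opmat_apply_le_sum_onorm:
  assumes I: "finite I" and T: "\<And>i j. i \<in> I \<Longrightarrow> j \<in> I \<Longrightarrow> bounded_linear (T i j)"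
    and v: "L2_set (\<lambda>j. norm (v j)) I \<le> 1"
  shows "L2_set (\<lambda>i. norm (\<Sum>j\<in>I. T i j (v j))) I \<le> (\<Sum>i\<in>I. \<Sum>j\<in>I. onorm (T i j))"
proof -
  have "norm (v j) \<le> 1" if "j \<in> I" for j
    using member_le_L2_set[OF I that, of "\<lambda>j. norm (v j)"] v by simp
  then have "norm (T i j (v j)) \<le> onorm (T i j)" if "i \<in> I" "j \<in> I" for i j
    using onorm[OF T[OF that], of "v j"] onorm_pos_le[OF T[OF that]] that
    by (meson mult_left_le order_trans)
  then have "(\<Sum>i\<in>I. norm (\<Sum>j\<in>I. T i j (v j))) \<le> (\<Sum>i\<in>I. \<Sum>j\<in>I. onorm (T i j))"
    by (intro sum_mono sum_norm_le)
  then show ?thesis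
    using L2_set_le_sum[of I "\<lambda>i. norm (\<Sum>j\<in>I. T i j (v j))"] by auto
qed

lemma opmat_norm_least:
  fixes T :: "'i \<Rightarrow> 'i \<Rightarrow> 'h \<Rightarrow> 'h::real_normed_vector"
  assumes "\<And>v. L2_set (\<lambda>j. norm (v j)) I \<le> 1 \<Longrightarrow> L2_set (\<lambda>i. norm (\<Sum>j\<in>I. T i j (v j))) I \<le> M"
  shows "opmat_norm I T \<le> M"
  unfolding opmat_norm_def
proof (rule cSUP_least)
  have "(\<lambda>_. 0) \<in> {v. L2_set (\<lambda>j. norm (v j :: 'h)) I \<le> 1}" by (simp add: L2_set_def)
  then show "{v. L2_set (\<lambda>j. norm (v j :: 'h)) I \<le> 1} \<noteq> {}" by (metis empty_iff)
qed (use assms in simp)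

lemma opmat_norm_le_sum_onorm:
  assumes "finite I" "\<And>i j. i \<in> I \<Longrightarrow> j \<in> I \<Longrightarrow> bounded_linear (T i j)"
  shows "opmat_norm I T \<le> (\<Sum>i\<in>I. \<Sum>j\<in>I. onorm (T i j))"
  by (rule opmat_norm_least, rule opmat_apply_le_sum_onorm[OF assms])

lemma opmat_norm_upper:
  assumes "finite I" "\<And>i j. i \<in> I \<Longrightarrow> j \<in> I \<Longrightarrow> bounded_linear (T i j)"
    and "L2_set (\<lambda>j. norm (v j)) I \<le> 1"
  shows "L2_set (\<lambda>i. norm (\<Sum>j\<in>I. T i j (v j))) I \<le> opmat_norm I T"
  unfolding opmat_norm_def
proof (rule cSUP_upper)
  show "bdd_above ((\<lambda>v. L2_set (\<lambda>i. norm (\<Sum>j\<in>I. T i j (v j))) I)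
      ` {v. L2_set (\<lambda>j. norm (v j)) I \<le> 1})"
    by (rule bdd_aboveI2, rule opmat_apply_le_sum_onorm[OF assms(1,2)]) simp_all
qed (use assms(3) in simp)

lemma opmat_norm_nonneg:
  assumes "finite I" "\<And>i j. i \<in> I \<Longrightarrow> j \<in> I \<Longrightarrow> bounded_linear (T i j)"
  shows "0 \<le> opmat_norm I T"
proof -
  have "0 \<le> L2_set (\<lambda>i. norm (\<Sum>j\<in>I. T i j 0)) I" by (rule L2_set_nonneg)
  also have "\<dots> \<le> opmat_norm I T"
    by (rule opmat_norm_upper[OF assms]) (simp_all add: L2_set_def)
  finally show ?thesis .
qed

text \<open>
  Apply the matrix to a vector supported on the single coordinate \<open>j\<close> and read off coordinate \<open>i\<close>.
\<close>

lemma norm_entry_le_opmat_norm: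
  assumes I: "finite I" and T: "\<And>i j. i \<in> I \<Longrightarrow> j \<in> I \<Longrightarrow> bounded_linear (T i j)"
    and ij: "i \<in> I" "j \<in> I" and w: "norm w \<le> 1"
  shows "norm (T i j w) \<le> opmat_norm I T"
proof -
  define v where "v = (\<lambda>q. if q = j then w else 0)"
  have "T p q (v q) = (if q = j then T p j w else 0)" if "p \<in> I" "q \<in> I" for p q
    using linear_0[OF bounded_linear.linear[OF T[OF that]]] by (simp add: v_def)
  then have "(\<Sum>q\<in>I. T i q (v q)) = T i j w"
    using ij I by (simp add: sum.delta)
  moreover have "L2_set (\<lambda>q. norm (v q)) I \<le> 1"
  proof -
    have "(norm (v q))\<^sup>2 = (if q = j then (norm w)\<^sup>2 else 0)" for q by (simp add: v_def)
    then show ?thesis using I ij w by (simp add: L2_set_def sum.delta)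
  qed
  ultimately show ?thesis
    using member_le_L2_set[OF I ij(1), of "\<lambda>i. norm (\<Sum>q\<in>I. T i q (v q))"]
      opmat_norm_upper[of I T v, OF I T] by simp
qed

text \<open>
  Relabelling coordinates is a unitary on the \<open>\<ell>\<^sub>2\<close>-sum, applied on both sides.
\<close>

lemma opmat_norm_reindex:
  assumes h: "inj_on h I"
  shows "opmat_norm (h ` I) T = opmat_norm I (\<lambda>i j. T (h i) (h j))"
proof -
  let ?R = "\<lambda>v. L2_set (\<lambda>i. norm (\<Sum>j\<in>I. T (h i) (h j) (v j))) I"
  have "opmat_norm (h ` I) T
      = (SUP v \<in> {v. L2_set (\<lambda>j. norm (v (h j))) I \<le> 1}. ?R (\<lambda>j. v (h j)))"
    unfolding opmat_norm_def by (simp add: L2_set_reindex[OF h] sum.reindex[OF h])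
  also have "(\<lambda>v. ?R (\<lambda>j. v (h j))) ` {v. L2_set (\<lambda>j. norm (v (h j))) I \<le> 1}
      = ?R ` {v. L2_set (\<lambda>j. norm (v j)) I \<le> 1}"
  proof (intro equalityI subsetI)
    fix r assume "r \<in> ?R ` {v. L2_set (\<lambda>j. norm (v j)) I \<le> 1}"
    then obtain v where v: "L2_set (\<lambda>j. norm (v j)) I \<le> 1" "r = ?R v" by blast
    define w where "w = (\<lambda>q. v (the_inv_into I h q))"
    have w: "w (h j) = v j" if "j \<in> I" for j
      using that h by (simp add: w_def the_inv_into_f_f)
    have "L2_set (\<lambda>j. norm (w (h j))) I = L2_set (\<lambda>j. norm (v j)) I"
      "?R (\<lambda>j. w (h j)) = ?R v"
      using w by (simp_all add: L2_set_def)
    with v show "r \<in> (\<lambda>v. ?R (\<lambda>j. v (h j))) ` {v. L2_set (\<lambda>j. norm (v (h j))) I \<le> 1}"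
      by (intro image_eqI[of _ _ w]) simp_all
  next
    fix r assume "r \<in> (\<lambda>v. ?R (\<lambda>j. v (h j))) ` {v. L2_set (\<lambda>j. norm (v (h j))) I \<le> 1}"
    then obtain v where "L2_set (\<lambda>j. norm (v (h j))) I \<le> 1" "r = ?R (\<lambda>j. v (h j))" by blast
    then show "r \<in> ?R ` {v. L2_set (\<lambda>j. norm (v j)) I \<le> 1}"
      by (intro image_eqI[of _ _ "\<lambda>j. v (h j)"]) simp_all
  qed
  finally show ?thesis by (simp add: opmat_norm_def)
qed

text \<open>
  The canonical shuffle \<open>M\<^sub>a(M\<^sub>b) \<cong> M\<^sub>b(M\<^sub>a)\<close> is isometric.  It reconciles the two orders in which
  indices occur: a dual norm puts the indices of the test matrix outside, a Lipschitz norm puts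
  those of the points outside.
\<close>

lemma block_norm_shuffle: "block_norm a b A = block_norm b a (\<lambda>i j p q. A p q i j)"
proof -
  have "prod.swap ` ({..<b} \<times> {..<a}) = {..<a} \<times> {..<b}" by (simp add: product_swap)
  then show ?thesis
    using opmat_norm_reindex[of prod.swap "{..<b} \<times> {..<a}" "\<lambda>(p, i) (q, j) z. A p q i j * z"]
    by (simp add: block_norm_def case_prod_unfold)
qed

lemma bounded_linear_block_entry:
  "bounded_linear ((\<lambda>(p, i) (q, j) z. A p q i j * (z::complex)) r s)"
  by (simp add: case_prod_unfold bounded_linear_mult_right)

lemma block_norm_nonneg: "0 \<le> block_norm a b A"
  unfolding block_norm_def
  by (rule opmat_norm_nonneg) (simp_all add: bounded_linear_block_entry)

lemma block_norm_cong:
  assumes "\<And>p q i j. p < a \<Longrightarrow> q < a \<Longrightarrow> i < b \<Longrightarrow> j < b \<Longrightarrow> A p q i j = B p q i j"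
  shows "block_norm a b A = block_norm a b B"
proof -
  have "L2_set (\<lambda>r. norm (\<Sum>s\<in>{..<a} \<times> {..<b}. (\<lambda>(p, i) (q, j) z. A p q i j * z) r s (v s))) ({..<a} \<times> {..<b})
      = L2_set (\<lambda>r. norm (\<Sum>s\<in>{..<a} \<times> {..<b}. (\<lambda>(p, i) (q, j) z. B p q i j * z) r s (v s))) ({..<a} \<times> {..<b})"
    for v
    using assms by (intro L2_set_cong refl arg_cong[of _ _ norm] sum.cong) (auto simp: case_prod_unfold)
  then show ?thesis unfolding block_norm_def opmat_norm_def by simp
qed

lemma block_norm_zero: "block_norm a b (\<lambda>_ _ _ _. 0) = 0"
proof (rule antisym[OF _ block_norm_nonneg])
  show "block_norm a b (\<lambda>_ _ _ _. 0) \<le> 0"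
    unfolding block_norm_def
    by (rule opmat_norm_least) (simp add: case_prod_unfold L2_set_def)
qed

lemma block_norm_le_sum:
  "block_norm a b A \<le> (\<Sum>(p, i)\<in>{..<a} \<times> {..<b}. \<Sum>(q, j)\<in>{..<a} \<times> {..<b}. cmod (A p q i j))"
proof -
  have "onorm (\<lambda>z. c * z) \<le> cmod c" for c :: complex
    by (rule onorm_bound) (simp_all add: norm_mult)
  then have "(\<Sum>r\<in>{..<a} \<times> {..<b}. \<Sum>s\<in>{..<a} \<times> {..<b}.
        onorm ((\<lambda>(p, i) (q, j) z. A p q i j * z) r s))
      \<le> (\<Sum>(p, i)\<in>{..<a} \<times> {..<b}. \<Sum>(q, j)\<in>{..<a} \<times> {..<b}. cmod (A p q i j))"
    by (auto simp: case_prod_unfold intro!: sum_mono)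
  moreover have "block_norm a b A \<le> (\<Sum>r\<in>{..<a} \<times> {..<b}. \<Sum>s\<in>{..<a} \<times> {..<b}.
        onorm ((\<lambda>(p, i) (q, j) z. A p q i j * z) r s))"
    unfolding block_norm_def
    by (rule opmat_norm_le_sum_onorm) (simp_all add: bounded_linear_block_entry)
  ultimately show ?thesis by linarith
qed

lemma cmod_entry_le_block_norm:
  assumes "p < a" "q < a" "i < b" "j < b"
  shows "cmod (A p q i j) \<le> block_norm a b A"
  using norm_entry_le_opmat_norm[of "{..<a} \<times> {..<b}"
      "\<lambda>(p, i) (q, j) z. A p q i j * z" "(p, i)" "(q, j)" 1] assms
  unfolding block_norm_def by (simp add: bounded_linear_block_entry)

lemma blinfun_mat_norm_upper:
  assumes "L2_set (\<lambda>j. norm (v j)) {..<n} \<le> 1"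
  shows "L2_set (\<lambda>i. norm (\<Sum>j<n. blinfun_apply (T i j) (v j))) {..<n} \<le> blinfun_mat_norm n T"
  unfolding blinfun_mat_norm_def
  by (rule opmat_norm_upper) (use assms in \<open>simp_all add: blinfun.bounded_linear_right\<close>)

lemma blinfun_mat_norm_nonneg: "0 \<le> blinfun_mat_norm n T"
  unfolding blinfun_mat_norm_def
  by (rule opmat_norm_nonneg) (simp_all add: blinfun.bounded_linear_right)

lemma norm_entry_le_blinfun_mat_norm:
  assumes "i < n" "j < n"
  shows "norm (T i j) \<le> blinfun_mat_norm n T"
proof (rule norm_blinfun_bound[OF blinfun_mat_norm_nonneg])
  fix w
  show "norm (blinfun_apply (T i j) w) \<le> blinfun_mat_norm n T * norm w"
  proof (cases "w = 0")
    case False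
    have "norm (blinfun_apply (T i j) (w /\<^sub>R norm w)) \<le> blinfun_mat_norm n T"
      unfolding blinfun_mat_norm_def
      by (rule norm_entry_le_opmat_norm[of "{..<n}" "\<lambda>i j. blinfun_apply (T i j)"])
        (use assms False in \<open>simp_all add: blinfun.bounded_linear_right\<close>)
    then show ?thesis
      using False by (simp add: blinfun.scaleR_right field_simps)
  qed simp
qed

lemma blinfun_mat_norm_le_sum:
  "blinfun_mat_norm n T \<le> (\<Sum>i<n. \<Sum>j<n. norm (T i j))"
  unfolding blinfun_mat_norm_def norm_blinfun.rep_eq
  by (rule opmat_norm_le_sum_onorm) (simp_all add: blinfun.bounded_linear_right)

section \<open>Lipschitz norms\<close>

text \<open>
  Matrix norms of a fixed size are equivalent to the maximum of the entry norms, so the entrywise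
  Lipschitz constants control the amplified map.  Without such a constant the infimum
  defining \<open>Lip_norm\<close> would be over the empty set.
\<close>

lemma Lip_norm_witness:
  assumes F: "F \<in> mats k (Lip0 X x0)"
  shows "\<exists>L\<ge>0. \<forall>x\<in>mats n X. \<forall>y\<in>mats n X.
    block_norm n k (\<lambda>p q i j. F i j (x p q) - F i j (y p q))
      \<le> L * blinfun_mat_norm n (\<lambda>p q. x p q - y p q)"
proof -
  have "\<forall>i j. \<exists>L. i < k \<longrightarrow> j < k \<longrightarrow> L-lipschitz_on X (F i j)"
    using F unfolding mats_def Lip0_def by blast
  then obtain L where L: "\<And>i j. i < k \<Longrightarrow> j < k \<Longrightarrow> (L i j)-lipschitz_on X (F i j)"
    by metis
  let ?C = "\<Sum>(p, i)\<in>{..<n} \<times> {..<k}. \<Sum>(q, j)\<in>{..<n} \<times> {..<k}. L i j"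
  have "0 \<le> ?C"
    using lipschitz_on_nonneg[OF L] by (auto intro!: sum_nonneg)
  moreover have "block_norm n k (\<lambda>p q i j. F i j (x p q) - F i j (y p q))
      \<le> ?C * blinfun_mat_norm n (\<lambda>p q. x p q - y p q)"
    if x: "x \<in> mats n X" and y: "y \<in> mats n X" for x y
  proof -
    let ?N = "blinfun_mat_norm n (\<lambda>p q. x p q - y p q)"
    have "cmod (F i j (x p q) - F i j (y p q)) \<le> L i j * ?N"
      if "p < n" "q < n" "i < k" "j < k" for p q i j
    proof -
      have "cmod (F i j (x p q) - F i j (y p q)) \<le> L i j * norm (x p q - y p q)"
        using lipschitz_onD[OF L[OF that(3,4)], of "x p q" "y p q"] x y that
        by (simp add: mats_def dist_norm)
      also have "\<dots> \<le> L i j * ?N"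
        using norm_entry_le_blinfun_mat_norm[OF that(1,2), of "\<lambda>p q. x p q - y p q"]
          lipschitz_on_nonneg[OF L[OF that(3,4)]] by (intro mult_left_mono)
      finally show ?thesis .
    qed
    then have "(\<Sum>(p, i)\<in>{..<n} \<times> {..<k}. \<Sum>(q, j)\<in>{..<n} \<times> {..<k}.
          cmod (F i j (x p q) - F i j (y p q)))
        \<le> (\<Sum>(p, i)\<in>{..<n} \<times> {..<k}. \<Sum>(q, j)\<in>{..<n} \<times> {..<k}. L i j * ?N)"
      by (auto intro!: sum_mono)
    also have "\<dots> = ?C * ?N"
      by (simp add: sum_distrib_right case_prod_unfold)
    finally show ?thesis
      using block_norm_le_sum[of n k "\<lambda>p q i j. F i j (x p q) - F i j (y p q)"] by linarith
  qed
  ultimately show ?thesis by blast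
qed

text \<open>
  The infimum of all admissible Lipschitz constants is itself admissible.
\<close>

lemma block_norm_le_Lip_norm:
  assumes F: "F \<in> mats k (Lip0 X x0)" and xy: "x \<in> mats n X" "y \<in> mats n X"
  shows "block_norm n k (\<lambda>p q i j. F i j (x p q) - F i j (y p q))
      \<le> Lip_norm X n k F * blinfun_mat_norm n (\<lambda>p q. x p q - y p q)"
proof -
  let ?S = "{L. 0 \<le> L \<and> (\<forall>x\<in>mats n X. \<forall>y\<in>mats n X.
    block_norm n k (\<lambda>p q i j. F i j (x p q) - F i j (y p q))
      \<le> L * blinfun_mat_norm n (\<lambda>p q. x p q - y p q))}"
  let ?B = "block_norm n k (\<lambda>p q i j. F i j (x p q) - F i j (y p q))"
  let ?N = "blinfun_mat_norm n (\<lambda>p q. x p q - y p q)"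
  obtain L where L: "L \<in> ?S" using Lip_norm_witness[OF F] by blast
  have S: "?B \<le> L * ?N" if "L \<in> ?S" for L using that xy by blast
  show ?thesis
  proof (cases "?N = 0")
    case True
    then show ?thesis using S[OF L] by simp
  next
    case False
    then have pos: "0 < ?N" using blinfun_mat_norm_nonneg[of n "\<lambda>p q. x p q - y p q"] by linarith
    have "?B / ?N \<le> Inf ?S"
      using L S pos by (intro cInf_greatest) (auto simp: pos_divide_le_eq)
    then show ?thesis using pos by (simp add: Lip_norm_def pos_divide_le_eq)
  qed
qed

lemma Lip_norm_le:
  assumes "0 \<le> L"
    and "\<And>x y. x \<in> mats n X \<Longrightarrow> y \<in> mats n X \<Longrightarrow>
      block_norm n k (\<lambda>p q i j. F i j (x p q) - F i j (y p q))
        \<le> L * blinfun_mat_norm n (\<lambda>p q. x p q - y p q)"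
  shows "Lip_norm X n k F \<le> L"
  unfolding Lip_norm_def
proof (rule cInf_lower)
  show "bdd_below {L. 0 \<le> L \<and> (\<forall>x\<in>mats n X. \<forall>y\<in>mats n X.
    block_norm n k (\<lambda>p q i j. F i j (x p q) - F i j (y p q))
      \<le> L * blinfun_mat_norm n (\<lambda>p q. x p q - y p q))}"
    by (rule bdd_belowI[of _ 0]) blast
qed (use assms in blast)

lemma Lip_norm_zero_le: "Lip_norm X n k (\<lambda>_ _ _. 0) \<le> 0"
  by (rule Lip_norm_le) (simp_all add: block_norm_zero)

lemma zero_in_Lip0: "(\<lambda>_. 0) \<in> Lip0 X x0"
  unfolding Lip0_def using lipschitz_on_constant by blast

lemma Lip0_add:
  assumes "f \<in> Lip0 X x0" "g \<in> Lip0 X x0"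
  shows "(\<lambda>x. f x + g x) \<in> Lip0 X x0"
  using assms unfolding Lip0_def by (auto intro: lipschitz_on_add)

lemma Lip0_scale:
  assumes "f \<in> Lip0 X x0"
  shows "(\<lambda>x. c * f x) \<in> Lip0 X x0"
proof -
  obtain L where "L-lipschitz_on X f" using assms unfolding Lip0_def by blast
  then have "(cmod c * L)-lipschitz_on X (\<lambda>x. c * f x)"
    by (auto simp: lipschitz_on_def dist_mult_left mult.assoc intro!: mult_left_mono)
  then show ?thesis using assms unfolding Lip0_def by auto
qed

section \<open>Point evaluations\<close>

text \<open>
  The bound \<open>|f(x)| \<le> \<parallel>x - x\<^sub>0\<parallel> Lip\<^sub>n(f)\<close> holds because \<open>M\<^sub>n(X)\<close> contains an isometric copy of the pair
  \<open>x, x\<^sub>0\<close>, namely the matrix with \<open>x\<close> in one corner and \<open>x\<^sub>0\<close> elsewhere and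
  the matrix with all entries \<open>x\<^sub>0\<close>.
\<close>

lemma delta_in_dual_space:
  assumes x0: "x0 \<in> X" and n: "n \<ge> 1" and x: "x \<in> X"
  shows "delta X x0 x \<in> dual_space (Lip0 X x0) (Lip_norm X n)"
proof -
  have "cmod (delta X x0 x f) \<le> norm (x - x0) * Lip_norm X n 1 (\<lambda>_ _. f)"
    if f: "f \<in> Lip0 X x0" for f
  proof -
    define M where "M = (\<lambda>(p::nat) (q::nat). if p = 0 \<and> q = 0 then x else x0)"
    have F: "(\<lambda>_ _. f) \<in> mats 1 (Lip0 X x0)" using f by (simp add: mats_def)
    have M: "M \<in> mats n X" "(\<lambda>_ _. x0) \<in> mats n X" using x x0 by (simp_all add: mats_def M_def)
    have "cmod (f x) = cmod (f (M 0 0) - f x0)"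
      using f by (simp add: M_def Lip0_def)
    also have "\<dots> \<le> block_norm n 1 (\<lambda>p q i j. f (M p q) - f x0)"
      by (rule cmod_entry_le_block_norm[where i = 0 and j = 0 and A = "\<lambda>p q i j. f (M p q) - f x0"])
        (use n in simp_all)
    also have "\<dots> \<le> Lip_norm X n 1 (\<lambda>_ _. f) * blinfun_mat_norm n (\<lambda>p q. M p q - x0)"
      using block_norm_le_Lip_norm[OF F M] by simp
    also have "\<dots> \<le> Lip_norm X n 1 (\<lambda>_ _. f) * norm (x - x0)"
    proof (rule mult_left_mono)
      have entry: "norm (M i j - x0) = (if j = 0 then if i = 0 then norm (x - x0) else 0 else 0)" for i j
        by (simp add: M_def)
      have "(\<Sum>i<n. \<Sum>j<n. norm (M i j - x0)) = norm (x - x0)"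
        unfolding entry using n by (simp add: sum.delta)
      then show "blinfun_mat_norm n (\<lambda>p q. M p q - x0) \<le> norm (x - x0)"
        using blinfun_mat_norm_le_sum[of n "\<lambda>p q. M p q - x0"] by simp
      show "0 \<le> Lip_norm X n 1 (\<lambda>_ _. f)"
        unfolding Lip_norm_def using Lip_norm_witness[OF F, of n] by (intro cInf_greatest) auto
    qed
    finally show ?thesis using f by (simp add: delta_def mult.commute)
  qed
  then show ?thesis
    unfolding dual_space_def by (auto simp: delta_def Lip0_add Lip0_scale)
qed

lemma delta_in_delta_span:
  assumes "x \<in> X"
  shows "delta X x0 x \<in> delta_span X x0"
proof -
  have "delta X x0 x = (\<lambda>f. \<Sum>z\<in>{x}. (\<lambda>_. 1) z * delta X x0 z f)" by simp
  moreover have "finite {x}" "{x} \<subseteq> X" using assms by simp_all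
  ultimately show ?thesis unfolding delta_span_def by (intro CollectI exI conjI)
qed

lemma dual_norm_zero:
  "dual_norm (Lip0 X x0) (Lip_norm X n) m (\<lambda>_ _ _. 0) = 0"
proof -
  have "(\<lambda>_ _ _. 0) \<in> mats 1 (Lip0 X x0)" "Lip_norm X n 1 (\<lambda>_ _ _. 0) \<le> 1"
    using Lip_norm_zero_le[of X n 1] by (simp_all add: mats_def zero_in_Lip0)
  then have "{block_norm k m (\<lambda>r s i j. 0) | k F.
      k \<ge> 1 \<and> F \<in> mats k (Lip0 X x0) \<and> Lip_norm X n k F \<le> 1} = {0}"
    by (auto simp: block_norm_zero)
  then show ?thesis by (simp add: dual_norm_def cb_norm_def)
qed

lemma delta_in_free_space:
  assumes "x0 \<in> X" "n \<ge> 1" "x \<in> X"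
  shows "delta X x0 x \<in> free_space X x0 n"
proof -
  have "free_norm X x0 n 1 (\<lambda>_ _ f. delta X x0 x f - delta X x0 x f) = 0"
    by (simp add: free_norm_def dual_norm_zero)
  then show ?thesis
    unfolding free_space_def
    using delta_in_dual_space[OF assms] delta_in_delta_span[OF assms(3), of x0]
    by (auto intro!: bexI[of _ "delta X x0 x"])
qed

section \<open>Compression to a finite-dimensional space\<close>

text \<open>
  The matrix of the compression of \<open>a - x\<^sub>0\<close> to the span of \<open>e\<close>.  The subtraction of \<open>x\<^sub>0\<close> makes the
  entries vanish at the base point, and the value off \<open>X\<close> follows the convention of \<open>Lip0\<close>.
\<close>

definition compression ::
  "('h::complex_hilbert \<Rightarrow>\<^sub>L 'h) set \<Rightarrow> ('h \<Rightarrow>\<^sub>L 'h) \<Rightarrow> (nat \<Rightarrow> 'h) \<Rightarrow> nat \<Rightarrow> nat \<Rightarrow> ('h \<Rightarrow>\<^sub>L 'h) \<Rightarrow> complex"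
  where "compression X x0 e i j =
    (\<lambda>a. if a \<in> X then cinner (blinfun_apply (a - x0) (e j)) (e i) else 0)"

lemma compression_diff:
  assumes "a \<in> X" "b \<in> X"
  shows "compression X x0 e i j a - compression X x0 e i j b
    = cinner (blinfun_apply (a - b) (e j)) (e i)"
  using assms by (simp add: compression_def blinfun.diff_left cinner_diff_left)

lemma compression_in_Lip0:
  assumes e: "orthonormal k e" and x0: "x0 \<in> X" and ij: "i < k" "j < k"
  shows "compression X x0 e i j \<in> Lip0 X x0"
proof -
  have "norm (e j) = 1"
    using e ij(2) by (simp add: orthonormal_def norm_eq_1 inner_eq_Re_cinner)
  then have "cmod (cinner (blinfun_apply T (e j)) (e i)) \<le> norm T" for T :: "'a \<Rightarrow>\<^sub>L 'a"
    using Bessel_inequality[OF e, of "blinfun_apply T (e j)"] norm_blinfun[of T "e j"] ij(1)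
      member_le_L2_set[of "{..<k}" i "\<lambda>i. cmod (cinner (blinfun_apply T (e j)) (e i))"] by simp
  then have "1-lipschitz_on X (compression X x0 e i j)"
    by (intro lipschitz_onI) (simp_all add: dist_norm compression_diff)
  then show ?thesis
    unfolding Lip0_def using x0 by (auto simp: compression_def)
qed

text \<open>
  The compressed matrix applied to coordinates \<open>c\<close>: assemble a vector of \<open>H\<^sup>n\<close> from \<open>c\<close>, apply
  the operator matrix, and take coordinates again.  This is where complex linearity of the operators
  enters.
\<close>

lemma compressed_matrix_apply:
  assumes T: "\<And>q. q < n \<Longrightarrow> T p q \<in> bounded_ops"
  shows "(\<Sum>s\<in>{..<n} \<times> {..<k}.
      (\<lambda>(p, i) (q, j) z. cinner (blinfun_apply (T p q) (e j)) (e i) * z) (p, i) s (c s))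
    = cinner (\<Sum>q<n. blinfun_apply (T p q) (\<Sum>j<k. c (q, j) *\<^sub>C e j)) (e i)"
proof -
  have "(\<Sum>j<k. cinner (blinfun_apply (T p q) (e j)) (e i) * c (q, j))
      = cinner (blinfun_apply (T p q) (\<Sum>j<k. c (q, j) *\<^sub>C e j)) (e i)" if "q < n" for q
    using T[OF that]
    by (simp add: bounded_ops_def blinfun.sum_right cinner_sum_left cinner_scaleC_left mult.commute)
  then have "cinner (\<Sum>q<n. blinfun_apply (T p q) (\<Sum>j<k. c (q, j) *\<^sub>C e j)) (e i)
      = (\<Sum>q<n. \<Sum>j<k. cinner (blinfun_apply (T p q) (e j)) (e i) * c (q, j))"
    by (simp add: cinner_sum_left)
  then show ?thesis
    by (simp add: sum.cartesian_product case_prod_unfold)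
qed

text \<open>
  Compression is completely contractive: assembling a vector from its coordinates is isometric by
  Parseval, and taking coordinates is contractive by Bessel.
\<close>

lemma block_norm_compressed_le:
  assumes e: "orthonormal k e" and T: "\<And>p q. p < n \<Longrightarrow> q < n \<Longrightarrow> T p q \<in> bounded_ops"
  shows "block_norm n k (\<lambda>p q i j. cinner (blinfun_apply (T p q) (e j)) (e i))
    \<le> blinfun_mat_norm n T"
  unfolding block_norm_def
proof (rule opmat_norm_least)
  fix c :: "nat \<times> nat \<Rightarrow> complex"
  assume c: "L2_set (\<lambda>s. norm (c s)) ({..<n} \<times> {..<k}) \<le> 1"
  define w where "w q = (\<Sum>j<k. c (q, j) *\<^sub>C e j)" for q
  define z where "z p = (\<Sum>q<n. blinfun_apply (T p q) (w q))" for p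
  have "L2_set (\<lambda>q. norm (w q)) {..<n} \<le> 1"
    using c by (simp add: L2_set_Times w_def norm_orthonormal_combination[OF e])
  then have z: "L2_set (\<lambda>p. norm (z p)) {..<n} \<le> blinfun_mat_norm n T"
    unfolding z_def by (rule blinfun_mat_norm_upper)
  have "L2_set (\<lambda>r. norm (\<Sum>s\<in>{..<n} \<times> {..<k}.
        (\<lambda>(p, i) (q, j) z. cinner (blinfun_apply (T p q) (e j)) (e i) * z) r s (c s)))
        ({..<n} \<times> {..<k})
      = L2_set (\<lambda>p. L2_set (\<lambda>i. cmod (cinner (z p) (e i))) {..<k}) {..<n}"
    unfolding L2_set_Times[OF norm_ge_zero]
  proof (intro L2_set_cong refl arg_cong[of _ _ cmod])
    fix p i assume "p \<in> {..<n}"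
    then show "(\<Sum>s\<in>{..<n} \<times> {..<k}.
        (\<lambda>(p, i) (q, j) z. cinner (blinfun_apply (T p q) (e j)) (e i) * z) (p, i) s (c s))
        = cinner (z p) (e i)"
      unfolding z_def w_def by (intro compressed_matrix_apply) (simp add: T)
  qed
  also have "\<dots> \<le> L2_set (\<lambda>p. norm (z p)) {..<n}"
    by (intro L2_set_mono Bessel_inequality[OF e] L2_set_nonneg)
  finally show "L2_set (\<lambda>r. norm (\<Sum>s\<in>{..<n} \<times> {..<k}.
        (\<lambda>(p, i) (q, j) z. cinner (blinfun_apply (T p q) (e j)) (e i) * z) r s (c s)))
        ({..<n} \<times> {..<k}) \<le> blinfun_mat_norm n T"
    using z by linarith
qed

text \<open>
  If the span of \<open>e\<close> contains the entries of both \<open>v\<close> and its image \<open>z\<close>, passing to coordinates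
  loses no norm on either side.
\<close>

lemma block_norm_compressed_ge:
  assumes e: "orthonormal k e" and T: "\<And>p q. p < n \<Longrightarrow> q < n \<Longrightarrow> T p q \<in> bounded_ops"
    and v: "L2_set (\<lambda>q. norm (v q)) {..<n} \<le> 1"
    and v_span: "\<And>q. q < n \<Longrightarrow> v q = (\<Sum>j<k. cinner (v q) (e j) *\<^sub>C e j)"
    and z_def: "\<And>p. z p = (\<Sum>q<n. blinfun_apply (T p q) (v q))"
    and z_span: "\<And>p. p < n \<Longrightarrow> z p = (\<Sum>j<k. cinner (z p) (e j) *\<^sub>C e j)"
  shows "L2_set (\<lambda>p. norm (z p)) {..<n}
    \<le> block_norm n k (\<lambda>p q i j. cinner (blinfun_apply (T p q) (e j)) (e i))"
proof -
  define c where "c = (\<lambda>(q, j). cinner (v q) (e j))"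
  have norms: "L2_set (\<lambda>j. cmod (cinner u (e j))) {..<k} = norm u"
    if "u = (\<Sum>j<k. cinner u (e j) *\<^sub>C e j)" for u
    using norm_orthonormal_combination[OF e, of "\<lambda>j. cinner u (e j)"] that by simp
  have c: "L2_set (\<lambda>s. norm (c s)) ({..<n} \<times> {..<k}) \<le> 1"
  proof -
    have "L2_set (\<lambda>s. norm (c s)) ({..<n} \<times> {..<k}) = L2_set (\<lambda>q. norm (v q)) {..<n}"
      unfolding L2_set_Times[OF norm_ge_zero]
      using norms[OF v_span] by (intro L2_set_cong) (simp_all add: c_def)
    then show ?thesis using v by simp
  qed
  have apply_c: "(\<Sum>s\<in>{..<n} \<times> {..<k}.
        (\<lambda>(p, i) (q, j) z. cinner (blinfun_apply (T p q) (e j)) (e i) * z) (p, i) s (c s))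
      = cinner (z p) (e i)" if "p < n" for p i
  proof -
    have "z p = (\<Sum>q<n. blinfun_apply (T p q) (\<Sum>j<k. c (q, j) *\<^sub>C e j))"
      unfolding z_def using v_span by (intro sum.cong) (simp_all add: c_def)
    then show ?thesis
      using compressed_matrix_apply[where n = n and T = T and p = p and k = k and e = e and i = i and c = c]
        T that by simp
  qed
  have "L2_set (\<lambda>p. norm (z p)) {..<n}
      = L2_set (\<lambda>p. L2_set (\<lambda>i. cmod (cinner (z p) (e i))) {..<k}) {..<n}"
    using z_span by (intro L2_set_cong) (simp_all add: norms)
  also have "\<dots> = L2_set (\<lambda>r. norm (\<Sum>s\<in>{..<n} \<times> {..<k}.
        (\<lambda>(p, i) (q, j) z. cinner (blinfun_apply (T p q) (e j)) (e i) * z) r s (c s)))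
        ({..<n} \<times> {..<k})"
    using apply_c by (simp only: L2_set_Times norm_ge_zero) (auto intro!: L2_set_cong)
  also have "\<dots> \<le> block_norm n k (\<lambda>p q i j. cinner (blinfun_apply (T p q) (e j)) (e i))"
    unfolding block_norm_def
    by (rule opmat_norm_upper) (use c in \<open>simp_all add: bounded_linear_block_entry\<close>)
  finally show ?thesis .
qed

lemma mats_diff_in_bounded_ops:
  assumes "X \<subseteq> bounded_ops" "x \<in> mats n X" "y \<in> mats n X" "p < n" "q < n"
  shows "x p q - y p q \<in> bounded_ops"
proof -
  have "x p q \<in> bounded_ops" "y p q \<in> bounded_ops" using assms by (auto simp: mats_def)
  moreover have "c *\<^sub>C a - c *\<^sub>C b = c *\<^sub>C (a - b)" for c and a b :: 'a
    using scaleC_add_right[of c "a - b" b] by (simp add: algebra_simps)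
  ultimately show ?thesis by (simp add: bounded_ops_def blinfun.diff_left)
qed

lemma Lip_norm_compression_le:
  assumes "orthonormal k e" "X \<subseteq> bounded_ops"
  shows "Lip_norm X n k (compression X x0 e) \<le> 1"
proof (rule Lip_norm_le)
  fix x y assume xy: "x \<in> mats n X" "y \<in> mats n X"
  have "block_norm n k (\<lambda>p q i j. compression X x0 e i j (x p q) - compression X x0 e i j (y p q))
      = block_norm n k (\<lambda>p q i j. cinner (blinfun_apply (x p q - y p q) (e j)) (e i))"
    using xy by (intro block_norm_cong compression_diff) (auto simp: mats_def)
  also have "\<dots> \<le> 1 * blinfun_mat_norm n (\<lambda>p q. x p q - y p q)"
    using block_norm_compressed_le[OF assms(1), of n "\<lambda>p q. x p q - y p q"]
      mats_diff_in_bounded_ops[OF assms(2) xy] by simp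
  finally show "block_norm n k
      (\<lambda>p q i j. compression X x0 e i j (x p q) - compression X x0 e i j (y p q))
      \<le> 1 * blinfun_mat_norm n (\<lambda>p q. x p q - y p q)" .
qed simp

text \<open>
  The dual norm tests \<open>\<delta>\<^sub>x - \<delta>\<^sub>y\<close> against all \<open>F\<close> in the unit balls of \<open>M\<^sub>k(Lip\<^sub>0)\<close>; after
  shuffling, the tested quantity is the one controlled by \<open>Lip\<^sub>n(F)\<close> when \<open>m = n\<close>.
\<close>

lemma free_norm_delta_diff:
  "free_norm X x0 n m (\<lambda>i j f. delta X x0 (x i j) f - delta X x0 (y i j) f) =
    Sup {block_norm m k (\<lambda>p q i j. F i j (x p q) - F i j (y p q)) | k F.
      k \<ge> 1 \<and> F \<in> mats k (Lip0 X x0) \<and> Lip_norm X n k F \<le> 1}"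
proof -
  have "block_norm k m (\<lambda>r s i j. delta X x0 (x i j) (F r s) - delta X x0 (y i j) (F r s))
      = block_norm m k (\<lambda>p q i j. F i j (x p q) - F i j (y p q))"
    if "F \<in> mats k (Lip0 X x0)" for k F
    by (subst block_norm_shuffle, rule block_norm_cong) (use that in \<open>simp add: delta_def mats_def\<close>)
  then have "{block_norm k m (\<lambda>r s i j. delta X x0 (x i j) (F r s) - delta X x0 (y i j) (F r s)) | k F.
      k \<ge> 1 \<and> F \<in> mats k (Lip0 X x0) \<and> Lip_norm X n k F \<le> 1} =
    {block_norm m k (\<lambda>p q i j. F i j (x p q) - F i j (y p q)) | k F.
      k \<ge> 1 \<and> F \<in> mats k (Lip0 X x0) \<and> Lip_norm X n k F \<le> 1}"
    by (intro Collect_cong ex_cong1) auto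
  then show ?thesis by (simp add: free_norm_def dual_norm_def cb_norm_def)
qed

lemma block_norm_le_of_Lip_norm_le_1:
  assumes "F \<in> mats k (Lip0 X x0)" "Lip_norm X n k F \<le> 1" "x \<in> mats n X" "y \<in> mats n X"
  shows "block_norm n k (\<lambda>p q i j. F i j (x p q) - F i j (y p q))
    \<le> blinfun_mat_norm n (\<lambda>p q. x p q - y p q)"
  using block_norm_le_Lip_norm[OF assms(1,3,4)]
    mult_right_mono[OF assms(2) blinfun_mat_norm_nonneg[of n "\<lambda>p q. x p q - y p q"]] by simp

lemma free_norm_delta_diff_le:
  assumes "x \<in> mats n X" "y \<in> mats n X"
  shows "free_norm X x0 n n (\<lambda>i j f. delta X x0 (x i j) f - delta X x0 (y i j) f)
    \<le> blinfun_mat_norm n (\<lambda>i j. x i j - y i j)"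
  unfolding free_norm_delta_diff
proof (rule cSup_least)
  have "(\<lambda>_ _ _. 0) \<in> mats 1 (Lip0 X x0)" "Lip_norm X n 1 (\<lambda>_ _ _. 0) \<le> 1"
    using Lip_norm_zero_le[of X n 1] by (simp_all add: mats_def zero_in_Lip0)
  then show "{block_norm n k (\<lambda>p q i j. F i j (x p q) - F i j (y p q)) | k F.
      k \<ge> 1 \<and> F \<in> mats k (Lip0 X x0) \<and> Lip_norm X n k F \<le> 1} \<noteq> {}"
    by blast
qed (use block_norm_le_of_Lip_norm_le_1 assms in blast)

lemma block_norm_le_free_norm:
  assumes "F \<in> mats k (Lip0 X x0)" "Lip_norm X n k F \<le> 1" "k \<ge> 1"
    and "x \<in> mats n X" "y \<in> mats n X"
  shows "block_norm n k (\<lambda>p q i j. F i j (x p q) - F i j (y p q))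
    \<le> free_norm X x0 n n (\<lambda>i j f. delta X x0 (x i j) f - delta X x0 (y i j) f)"
  unfolding free_norm_delta_diff
proof (rule cSup_upper)
  show "bdd_above {block_norm n k (\<lambda>p q i j. F i j (x p q) - F i j (y p q)) | k F.
      k \<ge> 1 \<and> F \<in> mats k (Lip0 X x0) \<and> Lip_norm X n k F \<le> 1}"
    by (rule bdd_aboveI[of _ "blinfun_mat_norm n (\<lambda>p q. x p q - y p q)"])
      (use block_norm_le_of_Lip_norm_le_1 assms(4,5) in blast)
qed (use assms in blast)

lemma free_norm_delta_diff_nonneg:
  assumes "x \<in> mats n X" "y \<in> mats n X"
  shows "0 \<le> free_norm X x0 n n (\<lambda>i j f. delta X x0 (x i j) f - delta X x0 (y i j) f)"
proof -
  have "(\<lambda>_ _ _. 0) \<in> mats 1 (Lip0 X x0)" "Lip_norm X n 1 (\<lambda>_ _ _. 0) \<le> 1"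
    using Lip_norm_zero_le[of X n 1] by (simp_all add: mats_def zero_in_Lip0)
  then show ?thesis
    using block_norm_le_free_norm[of "\<lambda>_ _ _. 0" 1 X x0 n x y] assms by (simp add: block_norm_zero)
qed

text \<open>
  One compression for each \<open>v\<close> in the unit ball of \<open>H\<^sup>n\<close> suffices, adapted to \<open>v\<close> and its image.
\<close>

lemma free_norm_delta_diff_ge:
  assumes X: "X \<subseteq> bounded_ops" and x0: "x0 \<in> X" and x: "x \<in> mats n X" and y: "y \<in> mats n X"
  shows "blinfun_mat_norm n (\<lambda>i j. x i j - y i j)
    \<le> free_norm X x0 n n (\<lambda>i j f. delta X x0 (x i j) f - delta X x0 (y i j) f)"
    (is "_ \<le> ?R")
  unfolding blinfun_mat_norm_def
proof (rule opmat_norm_least)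
  fix v :: "nat \<Rightarrow> 'a"
  assume v: "L2_set (\<lambda>q. norm (v q)) {..<n} \<le> 1"
  define T where "T p q = x p q - y p q" for p q
  define z where "z p = (\<Sum>q<n. blinfun_apply (T p q) (v q))" for p
  have T: "T p q \<in> bounded_ops" if "p < n" "q < n" for p q
    unfolding T_def using mats_diff_in_bounded_ops[OF X x y that] .
  obtain k e where e: "orthonormal k e"
    and span: "\<And>u. u \<in> v ` {..<n} \<union> z ` {..<n} \<Longrightarrow> u = (\<Sum>j<k. cinner u (e j) *\<^sub>C e j)"
    using finite_subset_orthonormal_span[of "v ` {..<n} \<union> z ` {..<n}"] by auto
  have "L2_set (\<lambda>p. norm (z p)) {..<n} \<le> ?R"
    \<comment> \<open>An empty system (all vectors zero) gives no test matrix, since those have size at least one.\<close>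
  proof (cases "k = 0")
    case True
    then have "z p = 0" if "p < n" for p using span[of "z p"] that by simp
    then have "L2_set (\<lambda>p. norm (z p)) {..<n} = 0" by (simp add: L2_set_def)
    then show ?thesis using free_norm_delta_diff_nonneg[OF x y, of x0] by simp
  next
    case False
    have "L2_set (\<lambda>p. norm (z p)) {..<n}
        \<le> block_norm n k (\<lambda>p q i j. cinner (blinfun_apply (T p q) (e j)) (e i))"
      by (rule block_norm_compressed_ge[OF e T v _ z_def]) (use span in auto)
    also have "\<dots> = block_norm n k
        (\<lambda>p q i j. compression X x0 e i j (x p q) - compression X x0 e i j (y p q))"
      unfolding T_def
      using x y by (intro block_norm_cong compression_diff[symmetric]) (auto simp: mats_def)
    also have "\<dots> \<le> ?R"
      using False Lip_norm_compression_le[OF e X] compression_in_Lip0[OF e x0] x y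
      by (intro block_norm_le_free_norm) (auto simp: mats_def)
    finally show ?thesis .
  qed
  then show "L2_set (\<lambda>i. norm (\<Sum>j<n. blinfun_apply (x i j - y i j) (v j))) {..<n} \<le> ?R"
    by (simp add: z_def T_def)
qed

theorem proposition3p7:
  fixes X :: "('h::complex_hilbert \<Rightarrow>\<^sub>L 'h) set" and x0 :: "'h \<Rightarrow>\<^sub>L 'h" and n :: nat
  assumes "pointed_op_metric_space X x0" and "n \<ge> 1"
  shows "(\<forall>x\<in>X. delta X x0 x \<in> free_space X x0 n) \<and>
    (\<forall>x\<in>mats n X. \<forall>y\<in>mats n X.
      free_norm X x0 n n (\<lambda>i j f. delta X x0 (x i j) f - delta X x0 (y i j) f)
        = blinfun_mat_norm n (\<lambda>i j. x i j - y i j))"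
proof -
  have X: "X \<subseteq> bounded_ops" "x0 \<in> X"
    using assms(1) by (simp_all add: pointed_op_metric_space_def)
  show ?thesis
    using delta_in_free_space[OF X(2) assms(2)]
      free_norm_delta_diff_le[of _ n X] free_norm_delta_diff_ge[OF X]
    by (blast intro: antisym)
qed

end
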